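(* Let $S$ be a locally porous relative Schottky set in a domain $D\subseteq\mathbb{C}$, and let $U\subseteq D$ be an open set such that $S\cap U$ is connected. Let $f\colon S\cap U\to S$ be a Schottky map and let $p\in S\cap U$. Assume that $f(p)=p$ and $f'(p)=1$. Then $f=\mathrm{id}$ on $S\cap U$, i.e. $f(q)=q$ for all $q\in S\cap U$.
   Context: A domain is an open connected subset of $\mathbb{C}$. A relative Schottky set in a domain $D\subseteq\mathbb{C}$ is a set of the form $S=D\setminus\bigcup_{i\in I}B_i$, where each $B_i$ is an open round disc with closure $\overline{B_i}\subseteq D$ and $\overline{B_i}\cap\overline{B_j}=\emptyset$ for $i\ne j$. If $D=\mathbb{C}$, the set $S$ is called a Schottky set, and in this case some $B_i$ are also allowed to be open half-planes. The relative Schottky set $S$ is locally porous at $p\in S$ if there exist a neighborhood $W$ of $p$ and constants $r_0>0$, $C\ge1$ such that for every $q\in S\cap W$ and every $0<r\le r_0$ there is $i\in I$ with $B(q,r)\cap B_i\neq\emptyset$ and $r/C\le\operatorname{diam}(B_i)\le Cr$, where $B(q,r)$ is the open disc of center $q$ and radius $r$. $S$ is locally porous if it is locally porous at every $p\in S$. Let $S$ and $\tilde S$ be relative Schottky sets in domains $D$ and $\tilde D$, and let $U\subseteq D$ be open. A map $f\colon S\cap U\to\tilde S$ is a local homeomorphism if for every $p\in S\cap U$ there is an open set $V\ni p$ such that $f(S\cap U\cap V)$ is open in $\tilde S$ and $f\colon S\cap U\cap V\to f(S\cap U\cap V)$ is a homeomorphism. Such a map $f$ is conformal at $p\in S\cap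 U$ if the limit $f'(p)=\lim_{q\in S,\,q\to p}\frac{f(q)-f(p)}{q-p}$ exists and is non-zero. A Schottky map $f\colon S\cap U\to\tilde S$ is a local homeomorphism that is conformal at every point of $S\cap U$ and whose derivative $f'$ is continuous on $S\cap U$. *)

theory Defs
  imports "HOL-Analysis.Analysis"
begin

definition domain_in_plane :: "complex set \<Rightarrow> bool" where
  "domain_in_plane D \<longleftrightarrow> open D \<and> connected D"

definition round_disc :: "complex set \<Rightarrow> bool" where
  "round_disc B \<longleftrightarrow> (\<exists>c r. 0 < r \<and> B = ball c r)"

definition half_plane :: "complex set \<Rightarrow> bool" where
  "half_plane B \<longleftrightarrow> (\<exists>a b. a \<noteq> 0 \<and> B = {z. a \<bullet> z < b})"

text \<open>\<open>S\<close> is a relative Schottky set in \<open>D\<close> with complementary components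
  \<open>B i\<close>, \<open>i \<in> I\<close>. Closures are taken in the plane. Half-planes are admitted
  only when \<open>D\<close> is the whole plane.\<close>

definition relative_schottky_set ::
    "complex set \<Rightarrow> 'i set \<Rightarrow> ('i \<Rightarrow> complex set) \<Rightarrow> complex set \<Rightarrow> bool" where
  "relative_schottky_set D I B S \<longleftrightarrow>
     domain_in_plane D \<and>
     S = D - (\<Union>i\<in>I. B i) \<and>
     (\<forall>i\<in>I. round_disc (B i) \<or> (D = UNIV \<and> half_plane (B i))) \<and>
     (\<forall>i\<in>I. closure (B i) \<subseteq> D) \<and>
     (\<forall>i\<in>I. \<forall>j\<in>I. i \<noteq> j \<longrightarrow> closure (B i) \<inter> closure (B j) = {})"

text \<open>The conjunct \<open>bounded (B i)\<close> excludes half-planes, whose diameter is infinite,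
  whereas \<^const>\<open>diameter\<close> has an unspecified real value on unbounded sets.\<close>

definition locally_porous_at ::
    "'i set \<Rightarrow> ('i \<Rightarrow> complex set) \<Rightarrow> complex set \<Rightarrow> complex \<Rightarrow> bool" where
  "locally_porous_at I B S p \<longleftrightarrow>
     (\<exists>W r0 C. open W \<and> p \<in> W \<and> 0 < r0 \<and> 1 \<le> C \<and>
       (\<forall>q \<in> S \<inter> W. \<forall>r. 0 < r \<and> r \<le> r0 \<longrightarrow>
         (\<exists>i\<in>I. ball q r \<inter> B i \<noteq> {} \<and> bounded (B i) \<and>
            r / C \<le> diameter (B i) \<and> diameter (B i) \<le> C * r)))"

definition locally_porous ::
    "'i set \<Rightarrow> ('i \<Rightarrow> complex set) \<Rightarrow> complex set \<Rightarrow> bool" where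
  "locally_porous I B S \<longleftrightarrow> (\<forall>p\<in>S. locally_porous_at I B S p)"

definition local_homeomorphism_on ::
    "complex set \<Rightarrow> complex set \<Rightarrow> (complex \<Rightarrow> complex) \<Rightarrow> bool" where
  "local_homeomorphism_on A T f \<longleftrightarrow>
     f ` A \<subseteq> T \<and>
     (\<forall>p\<in>A. \<exists>V. open V \<and> p \<in> V \<and>
        openin (top_of_set T) (f ` (A \<inter> V)) \<and>
        (\<exists>g. homeomorphism (A \<inter> V) (f ` (A \<inter> V)) f g))"

text \<open>Maps on \<open>S \<inter> U\<close> are total functions of which only the values on \<open>S \<inter> U\<close> matter.
  Since \<open>U\<close> is open, the limit of difference quotients for \<open>q \<in> S\<close>, \<open>q \<rightarrow> p\<close> is the
  limit within \<open>S \<inter> U\<close>; see \<open>has_field_derivative_iff\<close>. A relative Schottky set has no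
  isolated points, so the derivative is unique.\<close>

definition schottky_map ::
    "complex set \<Rightarrow> complex set \<Rightarrow> complex set \<Rightarrow> (complex \<Rightarrow> complex) \<Rightarrow> bool" where
  "schottky_map S U T f \<longleftrightarrow>
     local_homeomorphism_on (S \<inter> U) T f \<and>
     (\<exists>f'. (\<forall>p \<in> S \<inter> U. (f has_field_derivative f' p) (at p within S \<inter> U) \<and> f' p \<noteq> 0) \<and>
           continuous_on (S \<inter> U) f')"

end

theory Submission imports Defs begin

text \<open>
  The proof studies the displacement \<open>g x = f x - x\<close>. Where \<open>f' = 1\<close>, continuity of \<open>f'\<close>
  makes \<open>g'\<close> as small as desired nearby. Two points of \<open>S\<close> can be joined inside \<open>S\<close> by a
  path of comparable length: follow the segment between them and, whenever it crosses a
  complementary disc, go around the disc along the shorter arc of its circle. Hence a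
  small \<open>g'\<close> makes \<open>g\<close> a Lipschitz map with small constant
  (\<open>lipschitz_on_relative_schottky_set\<close>).

  Let \<open>f p = p\<close> and \<open>f' p = 1\<close>, and suppose that some \<open>q \<in> S\<close> near \<open>p\<close> is moved by
  \<open>v = g q \<noteq> 0\<close>. Since \<open>g p = 0\<close>, the length of \<open>v\<close> is small compared with the distance
  from \<open>q\<close> to \<open>p\<close>. Porosity provides a complementary disc at distance and of size
  comparable to \<open>\<bar>v\<bar>\<close>, but of radius at least \<open>\<bar>v\<bar>\<close>. At this scale \<open>f\<close> is almost the
  translation by \<open>v\<close>, so it pushes the point of the circle that is extreme in the direction
  \<open>-v\<close> into the disc. That point lies in \<open>S\<close>, and \<open>f\<close> maps \<open>S \<inter> U\<close> into \<open>S\<close>: a contradiction.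
  So \<open>f\<close> is the identity near \<open>p\<close>.

  The set where \<open>f q = q\<close> and \<open>f' q = 1\<close> is therefore open in \<open>S \<inter> U\<close>; it is closed by
  continuity, and \<open>S \<inter> U\<close> is connected.
\<close>

section \<open>Increments of a function along a closed set of reals\<close>

text \<open>A bound on the increments that holds infinitesimally to the right of each point of
  \<open>T\<close>, and across each gap of \<open>T\<close>, holds globally: at the largest point up to which the
  bound is known, one of the two hypotheses carries it further.\<close>

lemma increment_bound_across_gaps:
  fixes h :: "real \<Rightarrow> 'a::real_normed_vector"
  assumes T: "closed T" and ends: "a \<in> T" "b \<in> T" "a \<le> b"
    and cont: "continuous_on T h"
    and infinitesimal: "\<And>t. t \<in> T \<Longrightarrow>
      \<exists>d>0. \<forall>s\<in>T. t < s \<and> s < t + d \<longrightarrow> norm (h s - h t) \<le> K * (s - t)"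
    and gap: "\<And>s t. s \<in> T \<Longrightarrow> t \<in> T \<Longrightarrow> s < t \<Longrightarrow> {s<..<t} \<inter> T = {} \<Longrightarrow>
      norm (h t - h s) \<le> K * (t - s)"
  shows "norm (h b - h a) \<le> K * (b - a)"
proof -
  define A where "A = {t \<in> T \<inter> {a..b}. norm (h t - h a) \<le> K * (t - a)}"
  have "continuous_on (T \<inter> {a..b}) (\<lambda>t. norm (h t - h a))"
    by (intro continuous_intros continuous_on_subset[OF cont]) auto
  moreover have "continuous_on (T \<inter> {a..b}) (\<lambda>t. K * (t - a))"
    by (intro continuous_intros)
  moreover have "closed (T \<inter> {a..b})"
    using T by blast
  ultimately have "closed A"
    unfolding A_def by (rule continuous_on_closed_Collect_le)
  have "a \<in> A"
    using ends by (simp add: A_def)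
  have bdd: "bdd_above A"
    by (rule bdd_aboveI[of _ b]) (simp add: A_def)
  define m where "m = Sup A"
  have m: "m \<in> A"
    unfolding m_def using \<open>a \<in> A\<close> bdd \<open>closed A\<close> by (intro closed_contains_Sup) auto
  have extend: "t \<le> m" if "t \<in> T" "t \<le> b" "norm (h t - h m) \<le> K * (t - m)" for t
  proof (rule ccontr)
    assume "\<not> t \<le> m"
    have "norm (h t - h a) \<le> norm (h t - h m) + norm (h m - h a)"
      using norm_triangle_ineq[of "h t - h m" "h m - h a"] by simp
    also have "\<dots> \<le> K * (t - m) + K * (m - a)"
      using that m by (simp add: A_def)
    finally have "t \<in> A"
      using that m \<open>\<not> t \<le> m\<close> by (simp add: A_def algebra_simps)
    then have "t \<le> m"
      unfolding m_def using bdd by (rule cSup_upper)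
    with \<open>\<not> t \<le> m\<close> show False by simp
  qed
  have "m = b"
  proof (rule ccontr)
    assume "m \<noteq> b"
    then have "m < b" "m \<in> T"
      using m by (auto simp: A_def)
    obtain d where d: "d > 0"
      "\<And>s. s \<in> T \<Longrightarrow> m < s \<Longrightarrow> s < m + d \<Longrightarrow> norm (h s - h m) \<le> K * (s - m)"
      using infinitesimal[OF \<open>m \<in> T\<close>] by blast
    have free: "s \<notin> T" if "m < s" "s < m + d" "s \<le> b" for s
      using extend[of s] d(2)[of s] that by fastforce
    define e where "e = min b (m + d / 2)"
    have e: "m < e" "e \<le> b" "e < m + d"
      using \<open>m < b\<close> \<open>d > 0\<close> by (auto simp: e_def)
    define n where "n = Inf (T \<inter> {e..})"
    have nonempty: "b \<in> T \<inter> {e..}"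
      using e ends by simp
    have below: "bdd_below (T \<inter> {e..})"
      by auto
    have n: "n \<in> T \<inter> {e..}"
      unfolding n_def using nonempty below T by (intro closed_contains_Inf) auto
    have "n \<le> b"
      unfolding n_def using nonempty below by (rule cInf_lower)
    have "s \<notin> T" if "m < s" "s < n" for s
    proof (cases "s < e")
      case True
      with that e free show ?thesis by auto
    next
      case False
      then show ?thesis
        using cInf_lower[of s "T \<inter> {e..}"] below \<open>s < n\<close> by (force simp: n_def)
    qed
    then have "{m<..<n} \<inter> T = {}"
      by auto
    then have "norm (h n - h m) \<le> K * (n - m)"
      using gap[of m n] \<open>m \<in> T\<close> n e by simp
    then have "n \<le> m"
      using extend n \<open>n \<le> b\<close> by blast
    with n e show False by simp
  qed
  with m show ?thesis
    by (simp add: A_def)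
qed

section \<open>Increments of a function along a circle\<close>

text \<open>A chord of the unit circle is at least half as long as the arc it cuts off.\<close>

lemma abs_le_twice_dist_cis:
  assumes "\<bar>\<theta>\<bar> \<le> pi"
  shows "\<bar>\<theta>\<bar> \<le> 2 * cmod (cis \<theta> - 1)"
proof -
  define x where "x = \<theta> / 2"
  have "\<bar>x\<bar> \<le> pi / 2"
    using assms by (simp add: x_def)
  \<comment> \<open>The error of \<open>sin x\<close> against \<open>x\<close> is then at most \<open>\<bar>x\<bar> / 2\<close>, as \<open>1.7\<^sup>2 / 6 < 1 / 2\<close>.\<close>
  then have x: "\<bar>x\<bar> \<le> 1.7"
    using pi_approx by (simp add: field_simps)
  have "\<bar>sin x - x\<bar> \<le> \<bar>x\<bar> ^ 3 / 6"
    using Maclaurin_sin_bound[of x 3]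
    by (simp add: sin_coeff_def numeral_eq_Suc lessThan_Suc divide_simps)
  also have "\<bar>x\<bar> ^ 3 / 6 = \<bar>x\<bar> * (\<bar>x\<bar> ^ 2 / 6)"
    by (simp add: power2_eq_square power3_eq_cube)
  also have "\<bar>x\<bar> ^ 2 \<le> 1.7 ^ 2"
    using x by (intro power_mono) auto
  then have "\<bar>x\<bar> * (\<bar>x\<bar> ^ 2 / 6) \<le> \<bar>x\<bar> * (1 / 2)"
    by (intro mult_left_mono) (auto simp: power2_eq_square)
  finally have "\<bar>x\<bar> \<le> 2 * \<bar>sin x\<bar>"
    by linarith
  then show ?thesis
    using dist_exp_i_1[of \<theta>] by (simp add: x_def cis_conv_exp)
qed

lemma vector_derivative_increment_bound:
  fixes h :: "real \<Rightarrow> 'a::real_normed_vector"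
  assumes "convex Y"
    and "\<And>t. t \<in> Y \<Longrightarrow> (h has_vector_derivative h' t) (at t within Y)"
    and bound: "\<And>t. t \<in> Y \<Longrightarrow> norm (h' t) \<le> M"
    and "s \<in> Y" "t \<in> Y"
  shows "norm (h s - h t) \<le> M * norm (s - t)"
proof (rule differentiable_bound[OF \<open>convex Y\<close>])
  show "(h has_derivative (\<lambda>x. x *\<^sub>R h' u)) (at u within Y)" if "u \<in> Y" for u
    using assms(2)[OF that] by (simp add: has_vector_derivative_def)
  show "onorm (\<lambda>x. x *\<^sub>R h' u) \<le> M" if "u \<in> Y" for u
    using mult_right_mono[OF bound[OF that] abs_ge_zero]
    by (intro onorm_le) (simp add: mult.commute)
qed fact+

text \<open>The shorter arc between two points of a circle is at most twice as long as their
  distance, so it stays near them, and integrating the derivative along it bounds the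
  increment.\<close>

lemma increment_bound_on_circle:
  fixes g :: "complex \<Rightarrow> complex"
  assumes ab: "a \<in> sphere c r" "b \<in> sphere c r"
    and near: "sphere c r \<inter> cball a (2 * dist a b) \<subseteq> X"
    and deriv: "\<And>z. z \<in> X \<Longrightarrow> (g has_field_derivative g' z) (at z within X)"
    and bound: "\<And>z. z \<in> X \<Longrightarrow> norm (g' z) \<le> e"
  shows "norm (g b - g a) \<le> 2 * e * dist a b"
proof (cases "a = b")
  case False
  then have "a \<noteq> c"
    using ab by auto
  have "r > 0"
    using \<open>a \<noteq> c\<close> ab(1) by auto
  have "a \<in> X"
    using near ab by auto
  then have "e \<ge> 0"
    using bound norm_ge_zero order_trans by blast
  define w where "w = (b - c) / (a - c)"
  define \<theta> where "\<theta> = Arg w"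
  have "norm w = 1"
    using ab \<open>r > 0\<close> by (simp add: w_def norm_divide dist_norm norm_minus_commute)
  then have "w \<noteq> 0" by auto
  have w: "cis \<theta> = w"
    using cis_Arg[OF \<open>w \<noteq> 0\<close>] \<open>norm w = 1\<close> by (simp add: \<theta>_def sgn_eq)
  have "\<bar>\<theta>\<bar> \<le> pi"
    using Arg_bounded[of w] by (simp add: \<theta>_def abs_le_iff)
  have "(a - c) * w = b - c"
    using \<open>a \<noteq> c\<close> by (simp add: w_def)
  then have "(a - c) * (w - 1) = b - a"
    by (simp add: right_diff_distrib)
  then have "dist a b = norm ((a - c) * (w - 1))"
    by (simp add: dist_norm norm_minus_commute)
  also have "\<dots> = r * cmod (cis \<theta> - 1)"
    using ab by (simp add: w norm_mult dist_norm norm_minus_commute)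
  finally have length: "r * \<bar>\<theta>\<bar> \<le> 2 * dist a b"
    using abs_le_twice_dist_cis[OF \<open>\<bar>\<theta>\<bar> \<le> pi\<close>] \<open>r > 0\<close> by simp
  define \<phi> where "\<phi> t = c + (a - c) * exp (\<i> * of_real (t * \<theta>))" for t :: real
  define \<phi>' where "\<phi>' t = (a - c) * (\<i> * of_real \<theta> * exp (\<i> * of_real (t * \<theta>)))" for t :: real
  have \<phi>01: "\<phi> 0 = a" "\<phi> 1 = b"
    using w \<open>a \<noteq> c\<close> by (auto simp: \<phi>_def w_def cis_conv_exp)
  have \<phi>_deriv: "(\<phi> has_vector_derivative \<phi>' t) (at t within Y)" for t Y
    unfolding \<phi>_def \<phi>'_def of_real_mult
    by (rule has_vector_derivative_real_field
          [where f = "\<lambda>z. c + (a - c) * exp (\<i> * (z * of_real \<theta>))"])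
       (auto intro!: derivative_eq_intros)
  have norm_\<phi>': "norm (\<phi>' t) = r * \<bar>\<theta>\<bar>" for t
    using ab by (simp add: \<phi>'_def norm_mult dist_norm norm_minus_commute)
  have in_X: "\<phi> t \<in> X" if "t \<in> {0..1}" for t
  proof -
    have "norm (\<phi> t - \<phi> 0) \<le> r * \<bar>\<theta>\<bar> * norm (t - 0)"
      by (rule vector_derivative_increment_bound[where Y = "{0..1}", OF _ \<phi>_deriv])
         (use that in \<open>auto simp: norm_\<phi>'\<close>)
    also have "\<dots> \<le> r * \<bar>\<theta>\<bar> * 1"
      using that \<open>r > 0\<close> by (intro mult_left_mono) auto
    finally have "\<phi> t \<in> cball a (2 * dist a b)"
      using length \<phi>01 by (simp add: dist_norm norm_minus_commute)
    moreover have "\<phi> t \<in> sphere c r"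
      using ab by (simp add: \<phi>_def dist_norm norm_mult norm_minus_commute)
    ultimately show ?thesis
      using near by blast
  qed
  have "(g \<circ> \<phi> has_vector_derivative \<phi>' t * g' (\<phi> t)) (at t within {0..1})" if "t \<in> {0..1}" for t
    by (rule field_vector_diff_chain_within[OF \<phi>_deriv])
       (use that in_X in \<open>auto intro!: DERIV_subset[OF deriv]\<close>)
  then have "norm ((g \<circ> \<phi>) 1 - (g \<circ> \<phi>) 0) \<le> (r * \<bar>\<theta>\<bar> * e) * norm (1 - 0 :: real)"
    by (rule vector_derivative_increment_bound[where Y = "{0..1}", rotated])
       (use in_X bound \<open>r > 0\<close> in \<open>auto simp: norm_mult norm_\<phi>' intro!: mult_left_mono\<close>)
  also have "\<dots> \<le> 2 * dist a b * e"
    using length \<open>e \<ge> 0\<close> by (simp add: mult_right_mono)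
  finally show ?thesis
    by (simp add: \<phi>01 mult_ac)
qed simp

section \<open>Relative Schottky sets\<close>

lemma relative_schottky_set_open_component:
  assumes "relative_schottky_set D I B S" "i \<in> I"
  shows "open (B i)"
  using assms
  by (auto simp: relative_schottky_set_def round_disc_def half_plane_def open_halfspace_lt)

lemma relative_schottky_set_frontier_subset:
  assumes S: "relative_schottky_set D I B S" and i: "i \<in> I"
  shows "frontier (B i) \<subseteq> S"
proof
  fix x assume x: "x \<in> frontier (B i)"
  have "x \<in> closure (B i)" "x \<notin> B i"
    using x relative_schottky_set_open_component[OF S i] by (auto simp: frontier_def interior_open)
  have "x \<notin> B j" if "j \<in> I" for j
  proof (cases "j = i")
    case False
    then have "closure (B i) \<inter> closure (B j) = {}"
      using S i that unfolding relative_schottky_set_def by metis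
    then show ?thesis
      using \<open>x \<in> closure (B i)\<close> closure_subset[of "B j"] by blast
  qed (use \<open>x \<notin> B i\<close> in simp)
  moreover have "x \<in> D"
    using S i \<open>x \<in> closure (B i)\<close> unfolding relative_schottky_set_def by blast
  ultimately show "x \<in> S"
    using S by (auto simp: relative_schottky_set_def)
qed

lemma relative_schottky_set_sphere_subset:
  assumes "relative_schottky_set D I B S" "i \<in> I" "B i = ball c s" "s > 0"
  shows "sphere c s \<subseteq> S"
  using relative_schottky_set_frontier_subset[OF assms(1,2)] assms by simp

lemma not_bounded_half_plane:
  assumes "half_plane H"
  shows "\<not> bounded H"
proof
  assume "bounded H"
  obtain a b where H: "a \<noteq> 0" "H = {z. a \<bullet> z < b}"
    using assms by (auto simp: half_plane_def)
  obtain M where M: "\<And>z. z \<in> H \<Longrightarrow> norm z \<le> M"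
    using \<open>bounded H\<close> by (auto simp: bounded_iff)
  define t where "t = (\<bar>b\<bar> + 1) / (a \<bullet> a) + (\<bar>M\<bar> + 1) / norm a"
  have "a \<bullet> a > 0" "norm a > 0"
    using \<open>a \<noteq> 0\<close> by auto
  then have "(\<bar>b\<bar> + 1) / (a \<bullet> a) \<le> t" "(\<bar>M\<bar> + 1) / norm a \<le> t" "t \<ge> 0"
    by (auto simp: t_def)
  then have "t * (a \<bullet> a) \<ge> \<bar>b\<bar> + 1" "t * norm a \<ge> \<bar>M\<bar> + 1" "t \<ge> 0"
    using \<open>a \<bullet> a > 0\<close> \<open>norm a > 0\<close> by (simp_all add: pos_divide_le_eq)
  then have "- t *\<^sub>R a \<in> H" "norm (- t *\<^sub>R a) > M"
    by (auto simp: H)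
  with M[of "- t *\<^sub>R a"] show False
    by simp
qed

text \<open>Porosity in the form in which it is used: half-planes cannot occur in it because they
  are unbounded, and a disc that meets \<open>ball q r\<close> has its centre close to \<open>q\<close>.\<close>

lemma locally_porous_at_discs:
  assumes S: "relative_schottky_set D I B S" and "locally_porous_at I B S p"
  obtains W r0 C where "open W" "p \<in> W" "0 < r0" "1 \<le> C"
    "\<And>q r. q \<in> S \<Longrightarrow> q \<in> W \<Longrightarrow> 0 < r \<Longrightarrow> r \<le> r0 \<Longrightarrow>
      \<exists>c s. 0 < s \<and> sphere c s \<subseteq> S \<and> ball c s \<inter> S = {} \<and>
        dist q c < r + s \<and> r \<le> 2 * C * s \<and> 2 * s \<le> C * r"
proof -
  obtain W r0 C where W: "open W" "p \<in> W" "0 < r0" "1 \<le> C"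
    and por: "\<forall>q \<in> S \<inter> W. \<forall>r. 0 < r \<and> r \<le> r0 \<longrightarrow>
      (\<exists>i\<in>I. ball q r \<inter> B i \<noteq> {} \<and> bounded (B i) \<and>
        r / C \<le> diameter (B i) \<and> diameter (B i) \<le> C * r)"
    using assms(2) unfolding locally_porous_at_def by (elim exE conjE)
  show ?thesis
  proof (rule that[OF W])
    fix q r assume "q \<in> S" "q \<in> W" "0 < r" "r \<le> r0"
    then have "\<exists>i\<in>I. ball q r \<inter> B i \<noteq> {} \<and> bounded (B i) \<and>
        r / C \<le> diameter (B i) \<and> diameter (B i) \<le> C * r"
      using por by simp
    then obtain i where i: "i \<in> I" "ball q r \<inter> B i \<noteq> {}" "bounded (B i)"
      "r / C \<le> diameter (B i)" "diameter (B i) \<le> C * r"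
      by blast
    have "round_disc (B i) \<or> half_plane (B i)"
      using S i(1) unfolding relative_schottky_set_def by metis
    with not_bounded_half_plane i(3) have "round_disc (B i)"
      by blast
    then obtain c s where cs: "0 < s" "B i = ball c s"
      by (auto simp: round_disc_def)
    obtain z where "dist q z < r" "dist c z < s"
      using i cs by auto
    then have "dist q c < r + s"
      using dist_triangle2[of q c z] by simp
    moreover have "r / C \<le> 2 * s" "2 * s \<le> C * r"
      using i(4,5) cs by simp_all
    then have "r \<le> 2 * C * s" "2 * s \<le> C * r"
      using \<open>1 \<le> C\<close> by (simp_all add: pos_divide_le_eq mult_ac)
    moreover have "ball c s \<inter> S = {}"
      using S i(1) cs(2) by (auto simp: relative_schottky_set_def)
    moreover have "sphere c s \<subseteq> S"
      using relative_schottky_set_sphere_subset[OF S i(1) cs(2,1)] .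
    ultimately show "\<exists>c s. 0 < s \<and> sphere c s \<subseteq> S \<and> ball c s \<inter> S = {} \<and>
        dist q c < r + s \<and> r \<le> 2 * C * s \<and> 2 * s \<le> C * r"
      using \<open>0 < s\<close> by (intro exI[of _ c] exI[of _ s] conjI)
  qed
qed

text \<open>By porosity, arbitrarily small circles contained in \<open>S\<close> lie arbitrarily close to \<open>p\<close>.\<close>

lemma locally_porous_at_islimpt:
  assumes S: "relative_schottky_set D I B S" and por: "locally_porous_at I B S p" and "p \<in> S"
  shows "p islimpt S"
  unfolding islimpt_approachable
proof (intro allI impI)
  fix e :: real assume "e > 0"
  obtain W r0 C where W: "p \<in> W" "0 < r0" "1 \<le> C"
    and disc: "\<And>q r. q \<in> S \<Longrightarrow> q \<in> W \<Longrightarrow> 0 < r \<Longrightarrow> r \<le> r0 \<Longrightarrow>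
      \<exists>c s. 0 < s \<and> sphere c s \<subseteq> S \<and> ball c s \<inter> S = {} \<and>
        dist q c < r + s \<and> r \<le> 2 * C * s \<and> 2 * s \<le> C * r"
    using locally_porous_at_discs[OF S por] by metis
  define r where "r = min r0 (e / (1 + C))"
  have r: "0 < r" "r \<le> r0" "r + C * r \<le> e"
  proof -
    show "0 < r" "r \<le> r0" using W \<open>e > 0\<close> by (auto simp: r_def)
    have "(1 + C) * r \<le> (1 + C) * (e / (1 + C))"
      using W by (intro mult_left_mono) (auto simp: r_def)
    also have "\<dots> = e" using W by simp
    finally show "r + C * r \<le> e" by (simp add: distrib_right)
  qed
  obtain c s where cs: "0 < s" "sphere c s \<subseteq> S" "dist p c < r + s" "2 * s \<le> C * r"
    using disc[of p r] W r \<open>p \<in> S\<close> by blast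
  have near: "dist x p < e" if "x \<in> sphere c s" for x
    using that cs r dist_triangle[of x p c] by (auto simp: dist_commute)
  \<comment> \<open>At least one of two antipodal points differs from \<open>p\<close>.\<close>
  have "c + of_real s \<in> sphere c s" "c - of_real s \<in> sphere c s" "c + of_real s \<noteq> c - of_real s"
    using cs by (auto simp: dist_norm algebra_simps)
  then show "\<exists>x\<in>S. x \<noteq> p \<and> dist x p < e"
    using near cs(2) by (metis subsetD)
qed

text \<open>The complementary component that contains a point of an open segment avoiding \<open>S\<close>
  contains the whole open segment, because its frontier lies in \<open>S\<close>. It is not a half-plane,
  since the complement of a half-plane is convex and contains both ends of the segment.\<close>

lemma gap_of_segment_is_chord:
  assumes S: "relative_schottky_set D I B S"
    and ab: "a \<in> S" "b \<in> S" "a \<noteq> b"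
    and gap: "open_segment a b \<subseteq> D - S"
  obtains c s where "0 < s" "sphere c s \<subseteq> S" "a \<in> sphere c s" "b \<in> sphere c s"
proof -
  define m where "m = midpoint a b"
  have m: "m \<in> open_segment a b"
    using \<open>a \<noteq> b\<close> by (simp add: m_def)
  then have "m \<in> D - S"
    using gap by blast
  then obtain i where i: "i \<in> I" "m \<in> B i"
    using S by (auto simp: relative_schottky_set_def)
  have "open_segment a b \<inter> frontier (B i) = {}"
    using relative_schottky_set_frontier_subset[OF S i(1)] gap by blast
  then have sub: "open_segment a b \<subseteq> B i"
    using connected_Int_frontier[OF convex_connected[OF convex_open_segment], of a b "B i"] m i
    by blast
  have "closure (open_segment a b) \<subseteq> closure (B i)"
    using sub by (rule closure_mono)
  then have cl: "a \<in> closure (B i)" "b \<in> closure (B i)"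
    using \<open>a \<noteq> b\<close> by auto
  have notin: "a \<notin> B i" "b \<notin> B i"
    using ab S i by (auto simp: relative_schottky_set_def)
  have "\<not> half_plane (B i)"
  proof
    assume "half_plane (B i)"
    then obtain u t where "B i = {z. u \<bullet> z < t}"
      by (auto simp: half_plane_def)
    then have "t \<le> u \<bullet> a" "t \<le> u \<bullet> b" "u \<bullet> m < t"
      using notin i(2) by auto
    then show False
      by (simp add: m_def midpoint_def inner_add_right)
  qed
  moreover have "round_disc (B i) \<or> half_plane (B i)"
    using S i(1) unfolding relative_schottky_set_def by metis
  ultimately have "round_disc (B i)"
    by blast
  then obtain c s where cs: "0 < s" "B i = ball c s"
    by (auto simp: round_disc_def)
  show ?thesis
  proof (rule that)
    show "0 < s" by fact
    show "sphere c s \<subseteq> S"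
      using relative_schottky_set_sphere_subset[OF S i(1) cs(2,1)] .
    show "a \<in> sphere c s" "b \<in> sphere c s"
      using cl notin cs by auto
  qed
qed

text \<open>Relative Schottky sets are quasiconvex: replacing the chords of a segment in the
  complementary discs by arcs at most doubles its length. The arcs stay in the concentric
  disc of five times the radius, since a chord in \<open>ball p \<sigma>\<close> is shorter than \<open>2 * \<sigma>\<close> and the
  arc is at most twice as long. The hypothesis \<open>0 < e\<close> gives the factor \<open>2\<close> some room over the
  infinitesimal bound \<open>e\<close> at the points where the segment does not enter a gap.\<close>

lemma lipschitz_on_relative_schottky_set:
  fixes g :: "complex \<Rightarrow> complex"
  assumes S: "relative_schottky_set D I B S"
    and big: "ball p (5 * \<sigma>) \<subseteq> D"
    and X: "X = S \<inter> ball p (5 * \<sigma>)"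
    and deriv: "\<And>z. z \<in> X \<Longrightarrow> (g has_field_derivative g' z) (at z within X)"
    and bound: "\<And>z. z \<in> X \<Longrightarrow> norm (g' z) \<le> e"
    and "0 < e"
    and xy: "x \<in> S" "x \<in> ball p \<sigma>" "y \<in> S" "y \<in> ball p \<sigma>"
  shows "norm (g y - g x) \<le> 2 * e * dist x y"
proof (cases "x = y")
  case False
  define L where "L = dist x y"
  have "L > 0" using False by (simp add: L_def)
  have "\<sigma> > 0" using xy by (metis mem_ball zero_le_dist le_less_trans)
  define \<gamma> where "\<gamma> t = x + t *\<^sub>R (y - x)" for t
  have \<gamma>_dist: "dist (\<gamma> s) (\<gamma> t) = L * \<bar>s - t\<bar>" for s t
  proof -
    have "\<gamma> s - \<gamma> t = (s - t) *\<^sub>R (y - x)"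
      by (simp add: \<gamma>_def algebra_simps)
    then show ?thesis
      by (simp add: dist_norm L_def norm_minus_commute mult.commute)
  qed
  have \<gamma>_cont: "continuous_on Y \<gamma>" for Y
    unfolding \<gamma>_def by (intro continuous_intros)
  have \<gamma>_ball: "\<gamma> t \<in> ball p \<sigma>" if "t \<in> {0..1}" for t
  proof -
    have "\<gamma> t \<in> closed_segment x y"
      using that unfolding closed_segment_def \<gamma>_def
      by (intro CollectI exI[of _ t]) (simp add: algebra_simps)
    moreover have "closed_segment x y \<subseteq> ball p \<sigma>"
      using xy by (intro closed_segment_subset) auto
    ultimately show ?thesis by blast
  qed
  have \<gamma>_D: "\<gamma> t \<in> D" if "t \<in> {0..1}" for t
    using \<gamma>_ball[OF that] big \<open>\<sigma> > 0\<close> by auto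
  define T where "T = {t \<in> {0..1}. \<gamma> t \<in> S}"
  have T_X: "\<gamma> t \<in> X" if "t \<in> T" for t
    using that \<gamma>_ball[of t] \<open>\<sigma> > 0\<close> by (auto simp: T_def X)
  have "open (\<Union>i\<in>I. B i)"
    using relative_schottky_set_open_component[OF S] by blast
  then have "closed (- (\<Union>i\<in>I. B i))"
    by (rule closed_Compl)
  then have "closed ({0..1} \<inter> \<gamma> -` (- (\<Union>i\<in>I. B i)))"
    by (intro continuous_closed_preimage \<gamma>_cont) simp_all
  also have "{0..1} \<inter> \<gamma> -` (- (\<Union>i\<in>I. B i)) = T"
    using \<gamma>_D S by (auto simp: T_def relative_schottky_set_def)
  finally have "closed T" .
  have "continuous_on X g"
    using deriv by (intro DERIV_continuous_on)
  then have "continuous_on T (g \<circ> \<gamma>)"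
    using T_X by (intro continuous_on_compose[OF \<gamma>_cont]) (auto elim: continuous_on_subset)
  have "norm ((g \<circ> \<gamma>) 1 - (g \<circ> \<gamma>) 0) \<le> (2 * e * L) * (1 - 0)"
  proof (rule increment_bound_across_gaps[OF \<open>closed T\<close>])
    show "0 \<in> T" "1 \<in> T"
      using xy by (auto simp: T_def \<gamma>_def)
    show "continuous_on T (g \<circ> \<gamma>)" by fact
  next
    fix t assume "t \<in> T"
    define z where "z = \<gamma> t"
    have "z \<in> X" using T_X[OF \<open>t \<in> T\<close>] by (simp add: z_def)
    then have "(g has_derivative (*) (g' z)) (at z within X)"
      using deriv by (simp add: has_field_derivative_def)
    then obtain d where "d > 0" and d: "\<And>w. w \<in> X \<Longrightarrow> norm (w - z) < d \<Longrightarrow>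
        norm (g w - g z - g' z * (w - z)) \<le> e * norm (w - z)"
      using \<open>e > 0\<close> unfolding has_derivative_within_alt by meson
    have near: "norm (g w - g z) \<le> 2 * e * norm (w - z)" if "w \<in> X" "norm (w - z) < d" for w
    proof -
      have "norm (g w - g z) \<le> norm (g w - g z - g' z * (w - z)) + norm (g' z * (w - z))"
        using norm_triangle_ineq[of "g w - g z - g' z * (w - z)" "g' z * (w - z)"] by simp
      also have "\<dots> \<le> e * norm (w - z) + e * norm (w - z)"
        using d[OF that] bound[OF \<open>z \<in> X\<close>] by (intro add_mono) (auto simp: norm_mult mult_right_mono)
      finally show ?thesis by simp
    qed
    show "\<exists>d>0. \<forall>s\<in>T. t < s \<and> s < t + d \<longrightarrow>
        norm ((g \<circ> \<gamma>) s - (g \<circ> \<gamma>) t) \<le> 2 * e * L * (s - t)"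
    proof (intro exI[of _ "d / L"] conjI ballI impI)
      show "d / L > 0" using \<open>d > 0\<close> \<open>L > 0\<close> by simp
    next
      fix s assume s: "s \<in> T" "t < s \<and> s < t + d / L"
      then have "norm (\<gamma> s - z) < d"
        using \<gamma>_dist[of s t] \<open>L > 0\<close> by (simp add: z_def dist_norm field_simps)
      then show "norm ((g \<circ> \<gamma>) s - (g \<circ> \<gamma>) t) \<le> 2 * e * L * (s - t)"
        using near[OF T_X[OF s(1)]] \<gamma>_dist[of s t] s by (simp add: z_def dist_norm mult_ac)
    qed
  next
    fix s t assume st: "s \<in> T" "t \<in> T" "s < t" and gap: "{s<..<t} \<inter> T = {}"
    have dist_st: "dist (\<gamma> s) (\<gamma> t) = L * (t - s)"
      using \<gamma>_dist[of s t] \<open>s < t\<close> by simp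
    then have "\<gamma> s \<noteq> \<gamma> t"
      using \<open>L > 0\<close> \<open>s < t\<close> by auto
    have "open_segment (\<gamma> s) (\<gamma> t) \<subseteq> D - S"
    proof
      fix w assume "w \<in> open_segment (\<gamma> s) (\<gamma> t)"
      then obtain u where u: "0 < u" "u < 1" "w = (1 - u) *\<^sub>R \<gamma> s + u *\<^sub>R \<gamma> t"
        by (auto simp: in_segment)
      define r where "r = s + u * (t - s)"
      have "w = \<gamma> r"
        by (simp add: u r_def \<gamma>_def algebra_simps)
      have "r - s = u * (t - s)" "t - r = (1 - u) * (t - s)"
        by (simp_all add: r_def algebra_simps)
      then have "0 < r - s" "0 < t - r"
        using u \<open>s < t\<close> by simp_all
      then have "s < r" "r < t"
        by simp_all
      then have "r \<in> {0..1}" "r \<notin> T"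
        using st gap by (auto simp: T_def)
      then show "w \<in> D - S"
        using \<gamma>_D[of r] \<open>w = \<gamma> r\<close> by (simp add: T_def)
    qed
    moreover have "\<gamma> s \<in> S" "\<gamma> t \<in> S"
      using st by (auto simp: T_def)
    ultimately obtain c \<rho> where arc: "sphere c \<rho> \<subseteq> S" "\<gamma> s \<in> sphere c \<rho>" "\<gamma> t \<in> sphere c \<rho>"
      using gap_of_segment_is_chord[OF S _ _ \<open>\<gamma> s \<noteq> \<gamma> t\<close>] by metis
    have ends: "dist p (\<gamma> s) < \<sigma>" "dist p (\<gamma> t) < \<sigma>"
      using \<gamma>_ball st by (auto simp: T_def)
    have "dist (\<gamma> s) (\<gamma> t) < 2 * \<sigma>"
      using ends dist_triangle3[of "\<gamma> s" "\<gamma> t" p] by simp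
    moreover have "dist p w \<le> dist p (\<gamma> s) + dist (\<gamma> s) w" for w
      by (rule dist_triangle)
    ultimately have "cball (\<gamma> s) (2 * dist (\<gamma> s) (\<gamma> t)) \<subseteq> ball p (5 * \<sigma>)"
      using ends by (smt (verit) mem_ball mem_cball subsetI)
    then have "sphere c \<rho> \<inter> cball (\<gamma> s) (2 * dist (\<gamma> s) (\<gamma> t)) \<subseteq> X"
      using arc(1) by (auto simp: X)
    then have "norm (g (\<gamma> t) - g (\<gamma> s)) \<le> 2 * e * dist (\<gamma> s) (\<gamma> t)"
      using deriv bound by (rule increment_bound_on_circle[OF arc(2,3)])
    then show "norm ((g \<circ> \<gamma>) t - (g \<circ> \<gamma>) s) \<le> 2 * e * L * (t - s)"
      by (simp add: dist_st mult_ac)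
  qed simp
  then show ?thesis
    by (simp add: \<gamma>_def L_def)
qed simp

section \<open>Rigidity\<close>

text \<open>With \<open>v\<close> the displacement of a moved point \<open>q\<close>, porosity is used at the scale
  \<open>r = 2 * C * \<bar>v\<bar>\<close>, the smallest one that guarantees a disc of radius at least \<open>\<bar>v\<bar>\<close>.
  The points of its circle are within \<open>(1 + C) * r\<close> of \<open>q\<close>, so by the choice of \<open>e\<close> their
  displacements differ from \<open>v\<close> by less than \<open>\<bar>v\<bar>\<close>.\<close>

lemma fixed_point_with_derivative_1_locally_identity:
  assumes S: "relative_schottky_set D I B S" and por: "locally_porous_at I B S p"
    and "open U" "U \<subseteq> D" and p: "p \<in> S" "p \<in> U"
    and f_S: "f ` (S \<inter> U) \<subseteq> S"
    and deriv: "\<And>z. z \<in> S \<inter> U \<Longrightarrow> (f has_field_derivative f' z) (at z within S \<inter> U)"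
    and cont: "continuous_on (S \<inter> U) f'"
    and fixed: "f p = p" "f' p = 1"
  obtains \<delta> where "0 < \<delta>" "\<And>q. q \<in> S \<Longrightarrow> dist p q < \<delta> \<Longrightarrow> f q = q"
proof -
  obtain W r0 C where W: "open W" "p \<in> W" "0 < r0" "1 \<le> C"
    and disc: "\<And>q r. q \<in> S \<Longrightarrow> q \<in> W \<Longrightarrow> 0 < r \<Longrightarrow> r \<le> r0 \<Longrightarrow>
      \<exists>c s. 0 < s \<and> sphere c s \<subseteq> S \<and> ball c s \<inter> S = {} \<and>
        dist q c < r + s \<and> r \<le> 2 * C * s \<and> 2 * s \<le> C * r"
    using locally_porous_at_discs[OF S por] by metis
  define e where "e = 1 / (8 * C * (1 + C))"
  have e: "0 < e" "8 * (e * C * (1 + C)) = 1"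
    using W by (auto simp: e_def)
  have "e \<le> e * C * (1 + C)"
    using e(1) W mult_mono[of 1 C 1 "1 + C"] by (simp add: mult.assoc)
  then have "2 * e < 1"
    using e(2) by linarith
  obtain d where d: "d > 0" "\<And>z. z \<in> S \<inter> U \<Longrightarrow> dist z p < d \<Longrightarrow> dist (f' z) (f' p) < e"
    using cont p e(1) unfolding continuous_on_iff by blast
  obtain dU where dU: "dU > 0" "ball p dU \<subseteq> U"
    using \<open>open U\<close> p by (auto simp: open_contains_ball)
  obtain dW where dW: "dW > 0" "ball p dW \<subseteq> W"
    using W by (auto simp: open_contains_ball)
  define \<delta> where "\<delta> = min (min d dU / 10) (min dW (r0 / (2 * C)))"
  have \<delta>: "0 < \<delta>" "5 * (2 * \<delta>) \<le> d" "5 * (2 * \<delta>) \<le> dU" "\<delta> \<le> dW" "2 * C * \<delta> \<le> r0"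
  proof -
    show "0 < \<delta>" "5 * (2 * \<delta>) \<le> d" "5 * (2 * \<delta>) \<le> dU" "\<delta> \<le> dW"
      using d dU dW W by (auto simp: \<delta>_def)
    have "\<delta> \<le> r0 / (2 * C)"
      by (simp add: \<delta>_def)
    then show "2 * C * \<delta> \<le> r0"
      using W by (simp add: field_simps)
  qed
  define X where "X = S \<inter> ball p (5 * (2 * \<delta>))"
  define g where "g z = f z - z" for z
  have "ball p (5 * (2 * \<delta>)) \<subseteq> U"
    using \<delta> dU by auto
  then have X_U: "X \<subseteq> S \<inter> U"
    by (auto simp: X_def)
  have g_deriv: "(g has_field_derivative f' z - 1) (at z within X)" if "z \<in> X" for z
    unfolding g_def using deriv[of z] that X_U
    by (auto intro!: derivative_eq_intros intro: DERIV_subset)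
  have g_bound: "norm (f' z - 1) \<le> e" if "z \<in> X" for z
    using d(2)[of z] that X_U \<delta> fixed by (auto simp: X_def dist_norm norm_minus_commute)
  have lip: "norm (g y - g x) \<le> 2 * e * dist x y"
    if "x \<in> S" "x \<in> ball p (2 * \<delta>)" "y \<in> S" "y \<in> ball p (2 * \<delta>)" for x y
    using \<open>ball p (5 * (2 * \<delta>)) \<subseteq> U\<close> \<open>U \<subseteq> D\<close>
    by (intro lipschitz_on_relative_schottky_set[OF S _ X_def g_deriv g_bound e(1) that]) auto
  have "f q = q" if q: "q \<in> S" "dist p q < \<delta>" for q
  proof (rule ccontr)
    assume "f q \<noteq> q"
    define v where "v = g q"
    have "v \<noteq> 0"
      using \<open>f q \<noteq> q\<close> by (simp add: v_def g_def)
    have "norm (g q - g p) \<le> 2 * e * dist p q"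
      using \<delta> p q by (intro lip) auto
    then have v_small: "norm v \<le> 2 * e * dist p q"
      by (simp add: v_def g_def fixed)
    also have "\<dots> \<le> 2 * e * \<delta>"
      using q e by (intro mult_left_mono) auto
    finally have v_le: "norm v \<le> 2 * e * \<delta>" .
    also have "\<dots> \<le> 1 * \<delta>"
      using \<open>2 * e < 1\<close> \<delta> by (intro mult_right_mono) auto
    finally have "norm v \<le> \<delta>" by simp
    define r where "r = 2 * C * norm v"
    have "r > 0"
      using \<open>v \<noteq> 0\<close> W by (simp add: r_def)
    have "r \<le> 2 * C * \<delta>"
      unfolding r_def using \<open>norm v \<le> \<delta>\<close> W by (intro mult_left_mono) auto
    then have "r \<le> r0"
      using \<delta> by simp
    have "q \<in> W"
      using q \<delta> dW by auto
    obtain c s where cs: "0 < s" "sphere c s \<subseteq> S" "ball c s \<inter> S = {}"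
      "dist q c < r + s" "r \<le> 2 * C * s" "2 * s \<le> C * r"
      using disc[OF q(1) \<open>q \<in> W\<close> \<open>r > 0\<close> \<open>r \<le> r0\<close>] by blast
    have "norm v \<le> s"
      using cs(5) W by (simp add: r_def)
    \<comment> \<open>The point of the circle that a translation by \<open>v\<close> pushes straight towards the centre.\<close>
    define x where "x = c - (s / norm v) *\<^sub>R v"
    have "dist c x = s"
      using \<open>v \<noteq> 0\<close> cs by (simp add: x_def dist_norm)
    then have "x \<in> S"
      using cs by auto
    have "dist q x < (1 + C) * r"
      using cs dist_triangle[of q x c] \<open>dist c x = s\<close> by (simp add: algebra_simps)
    also have "(1 + C) * r = 2 * (C * (1 + C)) * norm v"
      by (simp add: r_def)
    finally have qx: "dist q x < 2 * (C * (1 + C)) * norm v" .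
    also have "\<dots> \<le> 2 * (C * (1 + C)) * (2 * e * \<delta>)"
      using v_le W by (intro mult_left_mono) auto
    also have "\<dots> = 8 * (e * C * (1 + C)) * \<delta> / 2"
      by simp
    also have "\<dots> = \<delta> / 2"
      by (simp only: e(2))
    finally have "dist p x < 2 * \<delta>"
      using q \<delta>(1) dist_triangle[of p x q] by linarith
    then have "x \<in> U"
      using \<open>ball p (5 * (2 * \<delta>)) \<subseteq> U\<close> \<delta>(1) by auto
    have "norm (g x - v) \<le> 2 * e * dist q x"
      unfolding v_def using q \<delta> \<open>x \<in> S\<close> \<open>dist p x < 2 * \<delta>\<close> by (intro lip) auto
    also have "\<dots> \<le> 2 * e * (2 * (C * (1 + C)) * norm v)"
      using qx e by (intro mult_left_mono) auto
    also have "\<dots> = 8 * (e * C * (1 + C)) * (norm v / 2)"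
      by simp
    also have "\<dots> = norm v / 2"
      by (simp only: e(2) mult_1)
    also have "\<dots> < norm v"
      using \<open>v \<noteq> 0\<close> by simp
    finally have gx: "norm (g x - v) < norm v" .
    have "f x - c = (1 - s / norm v) *\<^sub>R v + (g x - v)"
      by (simp add: g_def x_def algebra_simps)
    then have "norm (f x - c) \<le> norm ((1 - s / norm v) *\<^sub>R v) + norm (g x - v)"
      by (metis norm_triangle_ineq)
    also have "norm ((1 - s / norm v) *\<^sub>R v) = \<bar>(1 - s / norm v) * norm v\<bar>"
      by (simp add: abs_mult)
    also have "(1 - s / norm v) * norm v = norm v - s"
      using \<open>v \<noteq> 0\<close> by (simp add: field_simps)
    also have "\<bar>norm v - s\<bar> = s - norm v"
      using \<open>norm v \<le> s\<close> by simp
    finally have "f x \<in> ball c s"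
      using gx by (simp add: dist_norm norm_minus_commute)
    moreover have "f x \<in> S"
      using f_S \<open>x \<in> S\<close> \<open>x \<in> U\<close> by blast
    ultimately show False
      using cs by blast
  qed
  with \<delta>(1) show ?thesis
    by (rule that)
qed

theorem theorem4p1:
  fixes D U S :: "complex set" and I :: "'i set" and B :: "'i \<Rightarrow> complex set"
    and f :: "complex \<Rightarrow> complex" and p :: complex
  assumes "relative_schottky_set D I B S"
    and "locally_porous I B S"
    and "open U" and "U \<subseteq> D"
    and "connected (S \<inter> U)"
    and "schottky_map S U S f"
    and "p \<in> S \<inter> U"
    and "f p = p"
    and "(f has_field_derivative 1) (at p within S \<inter> U)"
  shows "\<forall>q \<in> S \<inter> U. f q = q"
proof -
  obtain f' where deriv: "\<And>z. z \<in> S \<inter> U \<Longrightarrow> (f has_field_derivative f' z) (at z within S \<inter> U)"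
    and cont: "continuous_on (S \<inter> U) f'" and f_S: "f ` (S \<inter> U) \<subseteq> S"
    using assms(6) unfolding schottky_map_def local_homeomorphism_on_def by blast
  have por: "locally_porous_at I B S z" if "z \<in> S" for z
    using assms(2) that by (simp add: locally_porous_def)
  \<comment> \<open>The derivative \<open>f'\<close> is determined by \<open>f\<close>, since \<open>S \<inter> U\<close> has no isolated points.\<close>
  have f'_eq: "f' z = a" if "z \<in> S \<inter> U" "(f has_field_derivative a) (at z within S \<inter> U)" for z a
  proof -
    have "z islimpt S \<inter> U"
      using locally_porous_at_islimpt[OF assms(1) por] that \<open>open U\<close>
      by (intro islimpt_Int_eventually) (auto simp: eventually_at_in_open')
    then show ?thesis
      using deriv[OF that(1)] that(2) by (intro has_field_derivative_unique) (auto simp: trivial_limit_within)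
  qed
  have "f' p = 1"
    using f'_eq assms by blast
  define A where "A = {z \<in> S \<inter> U. f z - z = 0} \<inter> {z \<in> S \<inter> U. f' z = 1}"
  have "continuous_on (S \<inter> U) f"
    using deriv by (rule DERIV_continuous_on)
  then have "closedin (top_of_set (S \<inter> U)) A"
    unfolding A_def
    by (intro closedin_Int continuous_closedin_preimage_constant continuous_intros cont)
  moreover have "openin (top_of_set (S \<inter> U)) A"
  proof (subst openin_subopen, intro ballI)
    fix z assume "z \<in> A"
    then have z: "z \<in> S" "z \<in> U" "f z = z" "f' z = 1"
      by (auto simp: A_def)
    obtain \<delta> where \<delta>: "0 < \<delta>" "\<And>q. q \<in> S \<Longrightarrow> dist z q < \<delta> \<Longrightarrow> f q = q"
      using fixed_point_with_derivative_1_locally_identity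
        [OF assms(1) por[OF z(1)] assms(3,4) z(1,2) f_S deriv cont z(3,4)] by blast
    let ?N = "S \<inter> U \<inter> ball z \<delta>"
    have "q \<in> A" if "q \<in> ?N" for q
    proof -
      have "\<forall>\<^sub>F y in at q within S \<inter> U. y \<in> ball z \<delta>"
        unfolding eventually_at_topological
        using that by (intro exI[of _ "ball z \<delta>"]) auto
      then have "\<forall>\<^sub>F y in at q within S \<inter> U. y = f y"
        unfolding eventually_at_filter
        by eventually_elim (use \<delta>(2) in auto)
      then have "(f has_field_derivative 1) (at q within S \<inter> U)"
        unfolding has_field_derivative_def using that \<delta>(2)[of q]
        by (intro has_derivative_transform_eventually
              [OF DERIV_ident[unfolded has_field_derivative_def]]) auto
      then show "q \<in> A"
        using f'_eq[of q 1] \<delta>(2)[of q] that by (auto simp: A_def)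
    qed
    moreover have "openin (top_of_set (S \<inter> U)) ?N"
      by (intro openin_open_Int) simp
    ultimately show "\<exists>T. openin (top_of_set (S \<inter> U)) T \<and> z \<in> T \<and> T \<subseteq> A"
      using z \<delta>(1) by (intro exI[of _ ?N]) auto
  qed
  moreover have "p \<in> A"
    using assms \<open>f' p = 1\<close> by (simp add: A_def)
  ultimately have "A = S \<inter> U"
    using assms(5) unfolding connected_clopen by blast
  then show ?thesis
    by (auto simp: A_def)
qed

end
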